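(* Let $\Sigma=(A,B,C,D)$ be a real linear time-invariant system with state dimension $n$ and $m$ inputs and outputs that is minimal, passive and asymptotically stable. Let $X=X^\top\ge 0$ be a solution of the KYP inequality $\mathcal W(X)\ge0$ of $\Sigma$, let $\mathcal W(X)=[L\ \ M]^\top[L\ \ M]$ with $L\in\mathbb R^{k\times n}$, $M\in\mathbb R^{k\times m}$, and let $\Sigma_H=(A,B,L,M)$ be the corresponding spectral factor. Let $\tilde\Sigma_H=(\tilde A,\tilde B,\tilde L,\tilde M)$, with $\tilde A\in\mathbb R^{r\times r}$, $\tilde B\in\mathbb R^{r\times m}$, $\tilde L\in\mathbb R^{k\times r}$, $\tilde M\in\mathbb R^{k\times m}$, be a reduced-order model of $\Sigma_H$ of order $r$ (obtained by any model reduction method). Define $$\tilde D:=\tfrac12\tilde M^\top\tilde M+\tfrac12(D-D^\top),\qquad \tilde C:=\tilde B^\top\tilde X+\tilde M^\top\tilde L,$$ where $\tilde X=\tilde X^\top\ge 0$, $\tilde X\in\mathbb R^{r\times r}$, solves the Lyapunov equation $\tilde A^\top\tilde X+\tilde X\tilde A+\tilde L^\top\tilde L=0$. If $\tilde\Sigma_H$ is minimal and asymptotically stable, then the reduced-order model $\tilde\Sigma=(\tilde A,\tilde B,\tilde C,\tilde D)$ is asymptotically stable and passive.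
   Context: A system $(A,B,C,D)$ with $A\in\mathbb R^{n\times n}$, $B\in\mathbb R^{n\times m}$, $C\in\mathbb R^{p\times n}$, $D\in\mathbb R^{p\times m}$ means $\dot x=Ax+Bu$, $y=Cx+Du$. It is minimal if $\operatorname{rank}[sI_n-A,\ B]=n=\operatorname{rank}[sI_n-A^\top,\ C^\top]$ for all $s\in\mathbb C$, and asymptotically stable if all eigenvalues of $A$ have negative real part. For $p=m$, the system is passive if there is a function $\mathcal H:\mathbb R^n\to[0,\infty)$ (storage function) such that $\mathcal H(x(t_1))-\mathcal H(x(t_0))\le\int_{t_0}^{t_1}y(\tau)^\top u(\tau)\,d\tau$ for all $t_1\ge t_0$ and all trajectories $(u,x,y)$ of the system. For $X=X^\top\in\mathbb R^{n\times n}$ put $$\mathcal W(X)=\begin{bmatrix}-A^\top X-XA & C^\top-XB\\ C-B^\top X & D+D^\top\end{bmatrix};$$ the KYP inequality is $\mathcal W(X)\ge0$ (positive semidefinite). *)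

theory Defs
  imports "HOL-Analysis.Analysis"
begin

text \<open>
  A linear time-invariant system \<open>x' = A x + B u\<close>, \<open>y = C x + D u\<close> with \<open>n\<close> states, \<open>m\<close> inputs
  and \<open>p\<close> outputs is given by its four matrices; the dimensions are the cardinalities of
  the finite index types.
\<close>

definition hblock :: "'a^'n^'k \<Rightarrow> 'a^'m^'k \<Rightarrow> 'a^('n + 'm)^'k" where
  "hblock P Q = (\<chi> i j. case j of Inl a \<Rightarrow> P $ i $ a | Inr b \<Rightarrow> Q $ i $ b)"

definition vblock :: "'a^'k^'n \<Rightarrow> 'a^'k^'m \<Rightarrow> 'a^'k^('n + 'm)" where
  "vblock P Q = (\<chi> i. case i of Inl a \<Rightarrow> P $ a | Inr b \<Rightarrow> Q $ b)"

abbreviation cmatrix :: "real^'n^'m \<Rightarrow> complex^'n^'m" where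
  "cmatrix \<equiv> map_matrix complex_of_real"

definition eigenvalue :: "'a::field^'n^'n \<Rightarrow> 'a \<Rightarrow> bool" where
  "eigenvalue A \<mu> \<longleftrightarrow> (\<exists>v. v \<noteq> 0 \<and> A *v v = \<mu> *s v)"

definition asymptotically_stable :: "real^'n^'n \<Rightarrow> bool" where
  "asymptotically_stable A \<longleftrightarrow> (\<forall>\<mu>. eigenvalue (cmatrix A) \<mu> \<longrightarrow> Re \<mu> < 0)"

text \<open>Minimality does not involve the feedthrough matrix \<open>D\<close>. Note that \<open>mat s\<close> is \<open>s I\<close>.\<close>

definition minimal :: "real^'n^'n \<Rightarrow> real^'m^'n \<Rightarrow> real^'n^'p \<Rightarrow> bool" where
  "minimal A B C \<longleftrightarrow>
     (\<forall>s. rank (hblock (mat s - cmatrix A) (cmatrix B)) = CARD('n) \<and>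
          rank (hblock (mat s - cmatrix (transpose A)) (cmatrix (transpose C))) = CARD('n))"

text \<open>Positive semidefiniteness includes symmetry.\<close>

definition psd :: "real^'n^'n \<Rightarrow> bool" where
  "psd X \<longleftrightarrow> transpose X = X \<and> (\<forall>v. 0 \<le> v \<bullet> (X *v v))"

definition kyp_matrix ::
  "real^'n^'n \<Rightarrow> real^'m^'n \<Rightarrow> real^'n^'m \<Rightarrow> real^'m^'m \<Rightarrow> real^'n^'n \<Rightarrow> real^('n + 'm)^('n + 'm)" where
  "kyp_matrix A B C D X =
     vblock (hblock (- (transpose A ** X) - X ** A) (transpose C - X ** B))
            (hblock (C - transpose B ** X) (D + transpose D))"

text \<open>
  Inputs are locally square integrable and the differential equation holds in the
  sense of Caratheodory, that is, in integrated form (so \<open>x\<close> is locally absolutely continuous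
  and \<open>x' = A x + B u\<close> almost everywhere). This is the largest usual class for which the
  supplied energy, the integral of the inner product of \<open>y\<close> and \<open>u\<close>, is always defined; by the
  lemma below it includes the classical solutions for continuous inputs.
\<close>

definition locally_square_integrable :: "(real \<Rightarrow> real^'m) \<Rightarrow> bool" where
  "locally_square_integrable u \<longleftrightarrow>
     u \<in> borel_measurable lebesgue \<and>
     (\<forall>a b. (\<lambda>t. (norm (u t))\<^sup>2) absolutely_integrable_on {a..b})"

definition trajectory ::
  "real^'n^'n \<Rightarrow> real^'m^'n \<Rightarrow> real^'n^'p \<Rightarrow> real^'m^'p \<Rightarrow>
   (real \<Rightarrow> real^'m) \<Rightarrow> (real \<Rightarrow> real^'n) \<Rightarrow> (real \<Rightarrow> real^'p) \<Rightarrow> bool" where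
  "trajectory A B C D u x y \<longleftrightarrow>
     locally_square_integrable u \<and>
     (\<forall>t0 t1. t0 \<le> t1 \<longrightarrow>
        ((\<lambda>\<tau>. A *v x \<tau> + B *v u \<tau>) has_integral (x t1 - x t0)) {t0..t1}) \<and>
     (\<forall>t. y t = C *v x t + D *v u t)"

definition is_passive ::
  "real^'n^'n \<Rightarrow> real^'m^'n \<Rightarrow> real^'n^'m \<Rightarrow> real^'m^'m \<Rightarrow> bool" where
  "is_passive A B C D \<longleftrightarrow>
     (\<exists>H :: real^'n \<Rightarrow> real. (\<forall>z. 0 \<le> H z) \<and>
        (\<forall>u x y t0 t1. trajectory A B C D u x y \<and> t0 \<le> t1 \<longrightarrow>
           H (x t1) - H (x t0) \<le> integral {t0..t1} (\<lambda>\<tau>. y \<tau> \<bullet> u \<tau>)))"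

lemma classical_trajectory:
  assumes u: "continuous_on UNIV u"
    and x: "\<And>t. (x has_vector_derivative (A *v x t + B *v u t)) (at t)"
    and y: "\<And>t. y t = C *v x t + D *v u t"
  shows "trajectory A B C D u x y"
  unfolding trajectory_def locally_square_integrable_def
proof (intro conjI allI impI)
  have "u \<in> borel_measurable borel"
    using u by (rule borel_measurable_continuous_onI)
  then show "u \<in> borel_measurable lebesgue"
    by (simp add: measurable_completion)
  show "(\<lambda>t. (norm (u t))\<^sup>2) absolutely_integrable_on {a..b}" for a b
    by (intro absolutely_integrable_continuous_real continuous_intros
        continuous_on_subset[OF u]) auto
  show "((\<lambda>\<tau>. A *v x \<tau> + B *v u \<tau>) has_integral (x t1 - x t0)) {t0..t1}"
    if "t0 \<le> t1" for t0 t1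
    using that x by (intro fundamental_theorem_of_calculus)
      (auto intro: has_vector_derivative_at_within)
qed (rule y)

end

theory Submission
  imports Defs
begin

text \<open>
  The storage function is \<open>H z = z \<bullet> X' z / 2\<close>. The Lyapunov equation and the choice of
  \<open>C'\<close> and \<open>D'\<close> make the dissipation rate a square:
  \<open>y \<bullet> u - d/dt H(x) = |L' x + M' u|\<^sup>2 / 2\<close>. As \<open>x\<close> is only absolutely continuous, the
  derivative of \<open>H(x)\<close> is used in integrated form, that is, as integration by parts
  for indefinite integrals.
\<close>

section \<open>Integration by parts for indefinite integrals\<close>

text \<open>Telescoping over a fine equidistant grid. This turns a bound on short intervals into one
  on \<open>{a..b}\<close> without any differentiability of \<open>F\<close>.\<close>

lemma small_increments_imp_bound:
  fixes F :: "real \<Rightarrow> 'a::real_normed_vector" and G :: "real \<Rightarrow> real"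
  assumes "a \<le> b" and "0 < d"
    and step: "\<And>s t. a \<le> s \<Longrightarrow> s \<le> t \<Longrightarrow> t \<le> b \<Longrightarrow> t - s < d \<Longrightarrow> norm (F t - F s) \<le> G t - G s"
  shows "norm (F b - F a) \<le> G b - G a"
proof -
  \<comment> \<open>The strict inequality makes the mesh \<open>h = (b - a) / N\<close> smaller than
    \<open>d\<close>, and forces \<open>N > 0\<close> even when \<open>a = b\<close>.\<close>
  obtain N :: nat where N: "(b - a) / d < real N"
    using reals_Archimedean2 by blast
  have "0 \<le> (b - a) / d"
    using assms by simp
  then have N0: "0 < real N"
    using N by linarith
  define h where "h = (b - a) / real N"
  have h: "0 \<le> h" "h < d" "real N * h = b - a"
    using N N0 assms by (auto simp: h_def field_simps)
  have "norm (F (a + real k * h) - F a) \<le> G (a + real k * h) - G a" if "k \<le> N" for k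
    using that
  proof (induction k)
    case (Suc k)
    have "real (Suc k) * h \<le> real N * h"
      using Suc.prems h by (intro mult_right_mono) auto
    then have le: "a + real (Suc k) * h \<le> b"
      using h by linarith
    have "norm (F (a + real (Suc k) * h) - F (a + real k * h))
        \<le> G (a + real (Suc k) * h) - G (a + real k * h)"
      using h le by (intro step) (auto simp: algebra_simps)
    then show ?case
      using Suc norm_triangle_ineq[of "F (a + real (Suc k) * h) - F (a + real k * h)"
          "F (a + real k * h) - F a"] by simp
  qed simp
  from this[of N] show ?thesis
    using h by simp
qed

text \<open>Up to the constant \<open>x a\<close>, the function is an indefinite integral, hence
  continuous in its upper limit.\<close>

lemma continuous_on_if_has_integral_increment:
  fixes x :: "real \<Rightarrow> 'a::banach"
  assumes x: "\<And>s t. a \<le> s \<Longrightarrow> s \<le> t \<Longrightarrow> t \<le> b \<Longrightarrow> (f has_integral (x t - x s)) {s..t}"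
  shows "continuous_on {a..b} x"
proof (cases "a \<le> b")
  case True
  have "continuous_on {a..b} (\<lambda>t. x a + integral {a..t} f)"
    using x[of a b] True by (intro continuous_intros indefinite_integral_continuous_1) auto
  moreover have "x a + integral {a..t} f = x t" if "t \<in> {a..b}" for t
    using integral_unique[OF x[of a t]] that by simp
  ultimately show ?thesis
    by (rule continuous_on_eq)
qed simp

text \<open>
  On \<open>{s..t}\<close> the increment of \<open>h (x \<tau>) (y \<tau>)\<close> is exactly the integral of
  \<open>h (x t) (g \<tau>) + h (f \<tau>) (y s)\<close>; by uniform continuity, replacing \<open>x t\<close> and \<open>y s\<close> by
  \<open>x \<tau>\<close> and \<open>y \<tau>\<close> costs at most \<open>\<epsilon>\<close> times the integral of \<open>|f| + |g|\<close> when \<open>t - s\<close> is small.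
\<close>

lemma integration_by_parts_indefinite_integral:
  fixes h :: "'a::euclidean_space \<Rightarrow> 'b::euclidean_space \<Rightarrow> 'c::euclidean_space"
    and x f :: "real \<Rightarrow> 'a" and y g :: "real \<Rightarrow> 'b"
  assumes h: "bounded_bilinear h" and ab: "a \<le> b"
    and f: "f absolutely_integrable_on {a..b}" and g: "g absolutely_integrable_on {a..b}"
    and x: "\<And>s t. a \<le> s \<Longrightarrow> s \<le> t \<Longrightarrow> t \<le> b \<Longrightarrow> (f has_integral (x t - x s)) {s..t}"
    and y: "\<And>s t. a \<le> s \<Longrightarrow> s \<le> t \<Longrightarrow> t \<le> b \<Longrightarrow> (g has_integral (y t - y s)) {s..t}"
  shows "((\<lambda>t. h (x t) (g t) + h (f t) (y t)) has_integral (h (x b) (y b) - h (x a) (y a))) {a..b}"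
proof -
  interpret bounded_bilinear h by fact
  have cx: "continuous_on {a..b} x"
    by (rule continuous_on_if_has_integral_increment[where f = f]) (rule x)
  have cy: "continuous_on {a..b} y"
    by (rule continuous_on_if_has_integral_increment[where f = g]) (rule y)
  \<comment> \<open>A continuous function on a compact interval is bounded and measurable, so its
    bilinear product with an absolutely integrable one stays absolutely integrable.\<close>
  have "(\<lambda>t. h (x t) (g t)) absolutely_integrable_on {a..b}"
    using cx g compact_continuous_image[OF cx]
    by (intro absolutely_integrable_bounded_measurable_product[OF bilinear_conv_bounded_bilinear[THEN iffD2, OF h]])
      (auto intro: continuous_imp_measurable_on_sets_lebesgue compact_imp_bounded)
  moreover have "(\<lambda>t. h (f t) (y t)) absolutely_integrable_on {a..b}"
    using cy f compact_continuous_image[OF cy]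
    by (intro absolutely_integrable_bounded_measurable_product[OF bilinear_conv_bounded_bilinear[THEN iffD2, OF flip]])
      (auto intro: continuous_imp_measurable_on_sets_lebesgue compact_imp_bounded)
  ultimately have ai: "(\<lambda>t. h (x t) (g t) + h (f t) (y t)) absolutely_integrable_on {a..b}"
    by (rule set_integral_add)
  define w where "w = (\<lambda>t. h (x t) (g t) + h (f t) (y t))"
  define N where "N = (\<lambda>t. norm (f t) + norm (g t))"
  have w: "w integrable_on {a..b}"
    using ai by (simp add: w_def absolutely_integrable_on_def)
  have N: "N integrable_on {a..b}"
    unfolding N_def using f g by (intro integrable_add) (auto simp: absolutely_integrable_on_def)
  have split: "integral {a..t} k - integral {a..s} k = integral {s..t} k"
    if "k integrable_on {a..b}" "a \<le> s" "s \<le> t" "t \<le> b"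
    for k :: "real \<Rightarrow> 'd::euclidean_space" and s t
    using Henstock_Kurzweil_Integration.integral_combine[of a s t k] that
      integrable_on_subinterval[OF that(1), of a t] by (auto simp: algebra_simps)
  \<comment> \<open>\<open>F\<close> is the defect of the formula: the claim is
    \<open>F b = F a\<close>, shown by bounding the change of \<open>F\<close> by arbitrarily small
    numbers.\<close>
  define F where "F = (\<lambda>t. h (x t) (y t) - integral {a..t} w)"
  obtain K where K: "0 < K" "\<And>p q. norm (h p q) \<le> norm p * norm q * K"
    using pos_bounded by blast
  have bound: "norm (F b - F a) \<le> e * K * integral {a..b} N" if e: "0 < e" for e
  proof -
    obtain d1 where d1: "0 < d1" "\<And>s t. s \<in> {a..b} \<Longrightarrow> t \<in> {a..b} \<Longrightarrow> dist t s < d1 \<Longrightarrow> dist (x t) (x s) < e"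
      using compact_uniformly_continuous[OF cx] e unfolding uniformly_continuous_on_def by force
    obtain d2 where d2: "0 < d2" "\<And>s t. s \<in> {a..b} \<Longrightarrow> t \<in> {a..b} \<Longrightarrow> dist t s < d2 \<Longrightarrow> dist (y t) (y s) < e"
      using compact_uniformly_continuous[OF cy] e unfolding uniformly_continuous_on_def by force
    \<comment> \<open>The vanishing integral over \<open>{a..a}\<close> is kept so that the right
      side is an increment of \<open>e * K * integral {a..t} N\<close>.\<close>
    have "norm (F b - F a) \<le> e * K * integral {a..b} N - e * K * integral {a..a} N"
    proof (rule small_increments_imp_bound[where d = "min d1 d2"])
      fix s t assume st: "a \<le> s" "s \<le> t" "t \<le> b" "t - s < min d1 d2"
      have Nst: "N integrable_on {s..t}" and wst: "w integrable_on {s..t}"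
        using N w st by (auto intro: integrable_on_subinterval)
      have "((\<lambda>\<tau>. h (x t) (g \<tau>) + h (f \<tau>) (y s)) has_integral
          (h (x t) (y t - y s) + h (x t - x s) (y s))) {s..t}"
        using has_integral_linear[OF x[OF st(1-3)] bounded_linear_left]
          has_integral_linear[OF y[OF st(1-3)] bounded_linear_right]
        by (intro has_integral_add) (auto simp: o_def)
      then have "((\<lambda>\<tau>. (h (x t) (g \<tau>) + h (f \<tau>) (y s)) - w \<tau>) has_integral
          (h (x t) (y t - y s) + h (x t - x s) (y s) - integral {s..t} w)) {s..t}"
        using wst by (intro has_integral_diff) auto
      \<comment> \<open>Discrete product rule: with one factor frozen at \<open>t\<close> and the
        other at \<open>s\<close>, the mixed terms \<open>h (x t) (y s)\<close> cancel.\<close>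
      moreover have "h (x t) (y t - y s) + h (x t - x s) (y s) - integral {s..t} w = F t - F s"
        using split[OF w st(1-3)] by (simp add: F_def diff_left diff_right algebra_simps)
      moreover have "(h (x t) (g \<tau>) + h (f \<tau>) (y s)) - w \<tau>
          = h (x t - x \<tau>) (g \<tau>) + h (f \<tau>) (y s - y \<tau>)" for \<tau>
        by (simp add: w_def diff_left diff_right)
      ultimately have hi: "((\<lambda>\<tau>. h (x t - x \<tau>) (g \<tau>) + h (f \<tau>) (y s - y \<tau>))
          has_integral (F t - F s)) {s..t}"
        by simp
      have "norm (h (x t - x \<tau>) (g \<tau>) + h (f \<tau>) (y s - y \<tau>)) \<le> e * K * N \<tau>"
        if \<tau>: "\<tau> \<in> {s..t}" for \<tau>
      proof -
        have "norm (x t - x \<tau>) \<le> e" "norm (y s - y \<tau>) \<le> e"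
          using d1(2)[of \<tau> t] d2(2)[of \<tau> s] \<tau> st by (auto simp: dist_norm)
        then have "norm (x t - x \<tau>) * norm (g \<tau>) * K \<le> e * norm (g \<tau>) * K"
          "norm (f \<tau>) * norm (y s - y \<tau>) * K \<le> norm (f \<tau>) * e * K"
          using K(1) by (auto intro!: mult_right_mono mult_left_mono)
        then show ?thesis
          using K(2)[of "x t - x \<tau>" "g \<tau>"] K(2)[of "f \<tau>" "y s - y \<tau>"]
            norm_triangle_ineq[of "h (x t - x \<tau>) (g \<tau>)" "h (f \<tau>) (y s - y \<tau>)"]
          by (simp add: N_def algebra_simps)
      qed
      then have "norm (integral {s..t} (\<lambda>\<tau>. h (x t - x \<tau>) (g \<tau>) + h (f \<tau>) (y s - y \<tau>)))
          \<le> integral {s..t} (\<lambda>\<tau>. e * K * N \<tau>)"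
        using hi Nst by (intro integral_norm_bound_integral integrable_on_mult_right) auto
      then show "norm (F t - F s) \<le> e * K * integral {a..t} N - e * K * integral {a..s} N"
        using integral_unique[OF hi] split[OF N st(1-3)]
        by (simp flip: right_diff_distrib)
    qed (use ab d1 d2 in auto)
    then show ?thesis
      by simp
  qed
  have "0 \<le> integral {a..b} N"
    using N by (rule integral_nonneg) (simp add: N_def)
  then have "0 \<le> K * integral {a..b} N"
    using K(1) by simp
  have "norm (F b - F a) \<le> 0"
  proof (rule field_le_epsilon)
    fix e :: real assume "0 < e"
    \<comment> \<open>Since \<open>c\<close> may be zero, the bound is applied with
      \<open>e / (c + 1)\<close>, which multiplied by \<open>c\<close> is at most
      \<open>e\<close>.\<close>
    define c where "c = K * integral {a..b} N"
    have c: "0 \<le> c"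
      unfolding c_def by fact
    have "norm (F b - F a) \<le> e / (c + 1) * c"
      using bound[of "e / (c + 1)"] \<open>0 < e\<close> c by (simp add: c_def mult.assoc)
    also have "\<dots> \<le> e"
      using \<open>0 < e\<close> c by (simp add: field_simps)
    finally show "norm (F b - F a) \<le> 0 + e"
      by simp
  qed
  then have "integral {a..b} w = h (x b) (y b) - h (x a) (y a)"
    by (simp add: F_def algebra_simps)
  with w show ?thesis
    unfolding w_def by (metis integrable_integral)
qed

section \<open>Integrability and energy balance along trajectories\<close>

lemma locally_square_integrable_measurable_on:
  assumes "locally_square_integrable u"
  shows "u \<in> borel_measurable (lebesgue_on {a..b})"
  using assms unfolding locally_square_integrable_def by (auto intro: measurable_restrict_space1)

text \<open>|u| is dominated by 1 + |u|^2, and the constant is integrable because the interval is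
  bounded.\<close>

lemma locally_square_integrable_imp_absolutely_integrable:
  fixes u :: "real \<Rightarrow> real^'m"
  assumes u: "locally_square_integrable u"
  shows "u absolutely_integrable_on {a..b}"
proof (rule measurable_bounded_by_integrable_imp_absolutely_integrable)
  show "(\<lambda>t. 1 + (norm (u t))\<^sup>2) integrable_on {a..b}"
    using u unfolding locally_square_integrable_def absolutely_integrable_on_def
    by (intro integrable_add) auto
  show "norm (u t) \<le> 1 + (norm (u t))\<^sup>2" for t
    using sum_squares_bound[of 1 "norm (u t)"] norm_ge_zero[of "u t"]
    unfolding power2_eq_square by linarith
qed (use u in \<open>auto intro: locally_square_integrable_measurable_on\<close>)

text \<open>By Cauchy-Schwarz and boundedness of \<open>P\<close>, the form is dominated by a
  multiple of |u|^2. This handles the feedthrough term of the supply rate.\<close>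

lemma locally_square_integrable_inner_matrix:
  fixes u :: "real \<Rightarrow> real^'m"
  assumes u: "locally_square_integrable u"
  shows "(\<lambda>t. (P *v u t) \<bullet> u t) absolutely_integrable_on {a..b}"
proof -
  obtain K where K: "\<And>v. norm (P *v v) \<le> norm v * K"
    using bounded_linear.bounded[OF matrix_vector_mul_bounded_linear] by blast
  show ?thesis
  proof (rule measurable_bounded_by_integrable_imp_absolutely_integrable)
    show "(\<lambda>t. K * (norm (u t))\<^sup>2) integrable_on {a..b}"
      using u unfolding locally_square_integrable_def absolutely_integrable_on_def
      by (intro integrable_on_mult_right) auto
    show "norm ((P *v u t) \<bullet> u t) \<le> K * (norm (u t))\<^sup>2" for t
      using Cauchy_Schwarz_ineq2[of "P *v u t" "u t"]
        mult_right_mono[OF K[of "u t"] norm_ge_zero[of "u t"]]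
      by (simp add: power2_eq_square algebra_simps)
    have "(\<lambda>t. P *v u t) \<in> borel_measurable (lebesgue_on {a..b})"
      by (rule borel_measurable_continuous_on[OF
            bounded_linear.continuous_on[OF matrix_vector_mul_bounded_linear continuous_on_id]
            locally_square_integrable_measurable_on[OF u]])
    then show "(\<lambda>t. (P *v u t) \<bullet> u t) \<in> borel_measurable (lebesgue_on {a..b})"
      using locally_square_integrable_measurable_on[OF u] by (rule borel_measurable_inner)
  qed auto
qed

lemma trajectory_imp_continuous_on:
  assumes "trajectory A B C D u x y"
  shows "continuous_on {a..b} x"
  using assms unfolding trajectory_def
  by (intro continuous_on_if_has_integral_increment[where f = "\<lambda>\<tau>. A *v x \<tau> + B *v u \<tau>"]) auto

text \<open>Integration by parts for the inner product of \<open>x\<close> and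
  \<open>X *v x\<close>, whose densities are \<open>A *v x + B *v u\<close> and its image under
  \<open>X\<close>; symmetry of \<open>X\<close> merges the two product terms.\<close>

lemma trajectory_quadratic_form_has_integral:
  fixes X :: "real^'n^'n"
  assumes tr: "trajectory A B C D u x y" and "t0 \<le> t1" and X: "transpose X = X"
  shows "((\<lambda>\<tau>. 2 * ((X *v x \<tau>) \<bullet> (A *v x \<tau> + B *v u \<tau>))) has_integral
      (x t1 \<bullet> (X *v x t1) - x t0 \<bullet> (X *v x t0))) {t0..t1}"
proof -
  let ?f = "\<lambda>\<tau>. A *v x \<tau> + B *v u \<tau>"
  have u: "locally_square_integrable u"
    and x: "\<And>s t. s \<le> t \<Longrightarrow> (?f has_integral (x t - x s)) {s..t}"
    using tr unfolding trajectory_def by auto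
  have "(\<lambda>\<tau>. A *v x \<tau>) absolutely_integrable_on {t0..t1}"
    by (intro absolutely_integrable_continuous_real
        bounded_linear.continuous_on[OF matrix_vector_mul_bounded_linear]
        trajectory_imp_continuous_on[OF tr])
  moreover have "(\<lambda>\<tau>. B *v u \<tau>) absolutely_integrable_on {t0..t1}"
    using absolutely_integrable_linear[OF locally_square_integrable_imp_absolutely_integrable[OF u]
        matrix_vector_mul_bounded_linear] by (simp add: o_def)
  ultimately have f: "?f absolutely_integrable_on {t0..t1}"
    by (rule set_integral_add)
  have g: "(\<lambda>\<tau>. X *v ?f \<tau>) absolutely_integrable_on {t0..t1}"
    using absolutely_integrable_linear[OF f matrix_vector_mul_bounded_linear] by (simp add: o_def)
  have Xx: "((\<lambda>\<tau>. X *v ?f \<tau>) has_integral (X *v x t - X *v x s)) {s..t}" if "s \<le> t" for s t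
    using has_integral_linear[OF x[OF that] matrix_vector_mul_bounded_linear[of X]]
    by (simp add: o_def matrix_vector_mult_diff_distrib)
  have sym: "v \<bullet> (X *v w) = (X *v v) \<bullet> w" for v w
    by (metis X dot_lmul_matrix vector_transpose_matrix)
  have "((\<lambda>\<tau>. x \<tau> \<bullet> (X *v ?f \<tau>) + ?f \<tau> \<bullet> (X *v x \<tau>)) has_integral
      (x t1 \<bullet> (X *v x t1) - x t0 \<bullet> (X *v x t0))) {t0..t1}"
    by (rule integration_by_parts_indefinite_integral[OF bounded_bilinear_inner \<open>t0 \<le> t1\<close> f g x Xx])
  moreover have "v \<bullet> (X *v w) + w \<bullet> (X *v v) = 2 * ((X *v v) \<bullet> w)" for v w
    using sym[of v w] inner_commute[of w "X *v v"] by linarith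
  ultimately show ?thesis
    by (simp only:)
qed

text \<open>The part from \<open>C\<close> is a bounded continuous factor times an integrable one,
  the part from \<open>D\<close> is quadratic in \<open>u\<close>. Integrability ensures that the
  supplied energy is a genuine integral and not the default value 0.\<close>

lemma trajectory_supply_rate_integrable:
  assumes tr: "trajectory A B C D u x y"
  shows "(\<lambda>\<tau>. y \<tau> \<bullet> u \<tau>) integrable_on {a..b}"
proof -
  have u: "locally_square_integrable u" and y: "\<And>t. y t = C *v x t + D *v u t"
    using tr unfolding trajectory_def by auto
  have Cx: "continuous_on {a..b} (\<lambda>\<tau>. C *v x \<tau>)"
    by (intro bounded_linear.continuous_on[OF matrix_vector_mul_bounded_linear]
        trajectory_imp_continuous_on[OF tr])
  have "(\<lambda>\<tau>. (C *v x \<tau>) \<bullet> u \<tau>) absolutely_integrable_on {a..b}"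
    using Cx compact_continuous_image[OF Cx]
      locally_square_integrable_imp_absolutely_integrable[OF u]
    by (intro absolutely_integrable_bounded_measurable_product[OF
          bilinear_conv_bounded_bilinear[THEN iffD2, OF bounded_bilinear_inner]])
      (auto intro: continuous_imp_measurable_on_sets_lebesgue compact_imp_bounded)
  then have "(\<lambda>\<tau>. (C *v x \<tau>) \<bullet> u \<tau> + (D *v u \<tau>) \<bullet> u \<tau>) absolutely_integrable_on {a..b}"
    using locally_square_integrable_inner_matrix[OF u] by (rule set_integral_add)
  then show ?thesis
    by (simp add: y inner_add_left absolutely_integrable_on_def)
qed

section \<open>Dissipation identity and passivity\<close>

text \<open>Completing the square: the Lyapunov equation yields |L v|^2, the choice of
  \<open>C\<close> cancels the \<open>X\<close>-\<open>B\<close> coupling and leaves the cross term,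
  and \<open>D\<close> yields |M w|^2. In matrix form, the KYP matrix of \<open>(A, B, C, D)\<close>
  at \<open>X\<close> equals \<open>transpose (hblock L M) ** hblock L M\<close>.\<close>

lemma dissipation_rate_eq:
  fixes A :: "real^'n^'n" and B :: "real^'m^'n" and L :: "real^'n^'k" and M :: "real^'m^'k"
  assumes X: "transpose X = X"
    and lyap: "transpose A ** X + X ** A + transpose L ** L = 0"
    and D: "D = (1/2) *\<^sub>R (transpose M ** M) + (1/2) *\<^sub>R (E - transpose E)"
    and C: "C = transpose B ** X + transpose M ** L"
  shows "2 * ((C *v v + D *v w) \<bullet> w) - 2 * ((X *v v) \<bullet> (A *v v + B *v w))
    = (norm (L *v v + M *v w))\<^sup>2"
proof -
  have adj: "(transpose P *v p) \<bullet> q = p \<bullet> (P *v q)" for P :: "real^'a^'b" and p q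
    by (metis dot_lmul_matrix transpose_matrix_vector)
  have "0 = ((transpose A ** X + X ** A + transpose L ** L) *v v) \<bullet> v"
    by (simp add: lyap)
  also have "\<dots> = 2 * ((X *v v) \<bullet> (A *v v)) + (L *v v) \<bullet> (L *v v)"
    using adj[of X "A *v v" v] inner_commute[of "A *v v" "X *v v"]
    by (simp add: matrix_vector_mult_add_rdistrib inner_add_left adj X
        del: transpose_matrix_vector flip: matrix_vector_mul_assoc)
  finally have "2 * ((X *v v) \<bullet> (A *v v)) = - ((L *v v) \<bullet> (L *v v))"
    by simp
  moreover have "(C *v v) \<bullet> w = (X *v v) \<bullet> (B *v w) + (L *v v) \<bullet> (M *v w)"
    by (simp add: C matrix_vector_mult_add_rdistrib inner_add_left adj
        del: transpose_matrix_vector flip: matrix_vector_mul_assoc)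
  \<comment> \<open>The skew-symmetric part \<open>E - transpose E\<close> has zero quadratic
    form.\<close>
  moreover have "2 * ((D *v w) \<bullet> w) = (M *v w) \<bullet> (M *v w)"
    by (simp add: D matrix_vector_mult_add_rdistrib matrix_vector_mult_diff_rdistrib
        inner_add_left inner_diff_left adj inner_commute[of w]
        del: transpose_matrix_vector flip: scaleR_matrix_vector_assoc matrix_vector_mul_assoc)
  ultimately show ?thesis
    by (simp add: power2_norm_eq_inner inner_add_left inner_add_right inner_commute algebra_simps)
qed

text \<open>Integrating the dissipation identity along a trajectory leaves a nonnegative square as
  the surplus of supplied over stored energy.\<close>

lemma lyapunov_imp_is_passive:
  fixes A :: "real^'n^'n" and B :: "real^'m^'n" and L :: "real^'n^'k" and M :: "real^'m^'k"
  assumes X: "psd X"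
    and lyap: "transpose A ** X + X ** A + transpose L ** L = 0"
    and D: "D = (1/2) *\<^sub>R (transpose M ** M) + (1/2) *\<^sub>R (E - transpose E)"
    and C: "C = transpose B ** X + transpose M ** L"
  shows "is_passive A B C D"
  unfolding is_passive_def
proof (intro exI[of _ "\<lambda>z. z \<bullet> (X *v z) / 2"] conjI allI impI)
  show "0 \<le> z \<bullet> (X *v z) / 2" for z
    using X by (simp add: psd_def)
next
  fix u x y and t0 t1 :: real
  assume "trajectory A B C D u x y \<and> t0 \<le> t1"
  then have tr: "trajectory A B C D u x y" and t: "t0 \<le> t1"
    by auto
  have sym: "transpose X = X"
    using X by (simp add: psd_def)
  have y: "y \<tau> = C *v x \<tau> + D *v u \<tau>" for \<tau>
    using tr by (simp add: trajectory_def)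
  have "((\<lambda>\<tau>. 2 * (y \<tau> \<bullet> u \<tau>)) has_integral 2 * integral {t0..t1} (\<lambda>\<tau>. y \<tau> \<bullet> u \<tau>)) {t0..t1}"
    using trajectory_supply_rate_integrable[OF tr] by (intro has_integral_mult_right) auto
  with trajectory_quadratic_form_has_integral[OF tr t sym]
  have "x t1 \<bullet> (X *v x t1) - x t0 \<bullet> (X *v x t0) \<le> 2 * integral {t0..t1} (\<lambda>\<tau>. y \<tau> \<bullet> u \<tau>)"
  \<comment> \<open>The integrands compare pointwise: their difference is |L x + M u|^2.\<close>
  proof (rule has_integral_le)
    show "2 * ((X *v x \<tau>) \<bullet> (A *v x \<tau> + B *v u \<tau>)) \<le> 2 * (y \<tau> \<bullet> u \<tau>)" for \<tau>
      using dissipation_rate_eq[OF sym lyap D C, of "x \<tau>" "u \<tau>"]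
        zero_le_power2[of "norm (L *v x \<tau> + M *v u \<tau>)"] by (simp only: y)
  qed
  then show "x t1 \<bullet> (X *v x t1) / 2 - x t0 \<bullet> (X *v x t0) / 2 \<le> integral {t0..t1} (\<lambda>\<tau>. y \<tau> \<bullet> u \<tau>)"
    by simp
qed

theorem theorem3p2:
  fixes A :: "real^'n^'n" and B :: "real^'m^'n" and C :: "real^'n^'m" and D :: "real^'m^'m"
    and X :: "real^'n^'n" and L :: "real^'n^'k" and M :: "real^'m^'k"
    and A' :: "real^'r^'r" and B' :: "real^'m^'r" and L' :: "real^'r^'k" and M' :: "real^'m^'k"
    and X' :: "real^'r^'r" and C' :: "real^'r^'m" and D' :: "real^'m^'m"
  assumes "minimal A B C" and "is_passive A B C D" and "asymptotically_stable A"
    and "psd X" and "psd (kyp_matrix A B C D X)"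
    and "kyp_matrix A B C D X = transpose (hblock L M) ** hblock L M"
    and "psd X'" and "transpose A' ** X' + X' ** A' + transpose L' ** L' = 0"
    and "D' = (1/2) *\<^sub>R (transpose M' ** M') + (1/2) *\<^sub>R (D - transpose D)"
    and "C' = transpose B' ** X' + transpose M' ** L'"
    and "minimal A' B' L'" and "asymptotically_stable A'"
  shows "asymptotically_stable A' \<and> is_passive A' B' C' D'"
  \<comment> \<open>Stability of \<open>A'\<close> is a hypothesis; passivity is the lemma at
    \<open>X'\<close> with \<open>E\<close> taken to be the original feedthrough
    \<open>D\<close>.\<close>
  using assms lyapunov_imp_is_passive by blast

end
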